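(* Let $T,S\in\mathcal{B}_A(\mathcal{H})$ and $\alpha\in[0,1]$. Then $$\|T+S\|_A^2\leq \sqrt{\left\|(T^{\sharp_A} T)^2+(S^{\sharp_A} S)^2\right\|_A+2w_A^2(S^{\sharp_A} T)}+(\alpha+1)\|T\|_A\|S\|_A+(1-\alpha)w_A(S^{\sharp_A} T).$$
   Context: $(\mathcal{H},\langle\cdot,\cdot\rangle)$ is a nontrivial complex Hilbert space, $\mathcal{B}(\mathcal{H})$ is the algebra of bounded linear operators on $\mathcal{H}$, and $A\in\mathcal{B}(\mathcal{H})$ is a positive operator, i.e. $\langle Ax,x\rangle\ge 0$ for all $x\in\mathcal{H}$. The semi-inner product induced by $A$ is $\langle x,y\rangle_A=\langle Ax,y\rangle$, with seminorm $\|x\|_A=\sqrt{\langle x,x\rangle_A}$ on $\mathcal{H}$. $\mathcal{B}_A(\mathcal{H})=\{T\in\mathcal{B}(\mathcal{H}): \operatorname{ran}(T^*A)\subseteq\operatorname{ran}(A)\}$ is the set of operators admitting an $A$-adjoint. For $T\in\mathcal{B}_A(\mathcal{H})$, $T^{\sharp_A}=A^{\dagger}T^*A$ (with $A^\dagger$ the Moore-Penrose inverse of $A$) is the unique bounded solution $X$ of $AX=T^*A$ whose range is contained in $\overline{\operatorname{ran}(A)}$; it satisfies $\langle Tx,y\rangle_A=\langle x,T^{\sharp_A}y\rangle_A$ for all $x,y\in\mathcal{H}$. For $T\in\mathcal{B}_A(\mathcal{H})$, the $A$-operator seminorm is $\|T\|_A=\sup\{\|Tx\|_A: x\in\mathcal{H},\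 \|x\|_A=1\}$ and the $A$-numerical radius is $w_A(T)=\sup\{|\langle Tx,x\rangle_A|: x\in\mathcal{H},\ \|x\|_A=1\}$; $w_A^2(T)$ means $(w_A(T))^2$. *)

theory Defs
  imports "HOL-Analysis.Analysis"
begin

text \<open>A complex Hilbert space: a Banach space whose real scalar multiplication and norm are those
  induced by a complex scalar multiplication and a complex inner product. The inner product is
  linear in the first argument. The zero space is an instance of this class.\<close>

class chilbert_space = banach +
  fixes scaleC :: "complex \<Rightarrow> 'a \<Rightarrow> 'a"
    and cinner :: "'a \<Rightarrow> 'a \<Rightarrow> complex"
  assumes scaleR_scaleC: "scaleR r x = scaleC (complex_of_real r) x"
    and scaleC_add_right: "scaleC c (x + y) = scaleC c x + scaleC c y"
    and scaleC_add_left: "scaleC (c + d) x = scaleC c x + scaleC d x"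
    and scaleC_scaleC: "scaleC c (scaleC d x) = scaleC (c * d) x"
    and cinner_add_left: "cinner (x + y) z = cinner x z + cinner y z"
    and cinner_scaleC_left: "cinner (scaleC c x) y = c * cinner x y"
    and cinner_commute: "cinner x y = cnj (cinner y x)"
    and cinner_self: "cinner x x = complex_of_real ((norm x)\<^sup>2)"

instantiation complex :: chilbert_space
begin

definition scaleC_complex :: "complex \<Rightarrow> complex \<Rightarrow> complex"
  where "scaleC_complex c x = c * x"

definition cinner_complex :: "complex \<Rightarrow> complex \<Rightarrow> complex"
  where "cinner_complex x y = x * cnj y"

instance
proof
  fix x :: complex
  show "cinner x x = complex_of_real ((norm x)\<^sup>2)"
    unfolding cinner_complex_def by (rule complex_norm_square [symmetric])
qed (simp_all add: scaleC_complex_def cinner_complex_def scaleR_conv_of_real algebra_simps)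

end

definition bounded_clinear :: "('a::chilbert_space \<Rightarrow> 'a) \<Rightarrow> bool"
  where "bounded_clinear T \<longleftrightarrow> bounded_linear T \<and> (\<forall>c x. T (scaleC c x) = scaleC c (T x))"

definition positive_op :: "('a::chilbert_space \<Rightarrow> 'a) \<Rightarrow> bool"
  where "positive_op A \<longleftrightarrow> bounded_clinear A \<and> (\<forall>x. cinner (A x) x \<in> \<real>\<^sub>\<ge>\<^sub>0)"

definition cadjoint :: "('a::chilbert_space \<Rightarrow> 'a) \<Rightarrow> 'a \<Rightarrow> 'a"
  where "cadjoint T = (THE S. bounded_clinear S \<and> (\<forall>x y. cinner (T x) y = cinner x (S y)))"

definition orth_compl :: "'a::chilbert_space set \<Rightarrow> 'a set"
  where "orth_compl M = {x. \<forall>y\<in>M. cinner x y = 0}"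

text \<open>The Moore-Penrose inverse of \<open>A\<close> is in general a densely defined unbounded operator with domain
  \<open>ran A + (ran A)\<^sup>\<bottom>\<close>: it inverts the restriction of \<open>A\<close> to \<open>(ker A)\<^sup>\<bottom>\<close> and vanishes on
  \<open>(ran A)\<^sup>\<bottom>\<close>. Outside this domain the value below is unspecified.\<close>

definition mp_inverse :: "('a::chilbert_space \<Rightarrow> 'a) \<Rightarrow> 'a \<Rightarrow> 'a"
  where "mp_inverse A y =
    (THE x. x \<in> orth_compl {z. A z = 0} \<and> y - A x \<in> orth_compl (range A))"

definition A_inner :: "('a::chilbert_space \<Rightarrow> 'a) \<Rightarrow> 'a \<Rightarrow> 'a \<Rightarrow> complex"
  where "A_inner A x y = cinner (A x) y"

definition A_norm :: "('a::chilbert_space \<Rightarrow> 'a) \<Rightarrow> 'a \<Rightarrow> real"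
  where "A_norm A x = sqrt (Re (A_inner A x x))"

definition A_adjointable :: "('a::chilbert_space \<Rightarrow> 'a) \<Rightarrow> ('a \<Rightarrow> 'a) set"
  where "A_adjointable A = {T. bounded_clinear T \<and> range (cadjoint T \<circ> A) \<subseteq> range A}"

definition A_adj :: "('a::chilbert_space \<Rightarrow> 'a) \<Rightarrow> ('a \<Rightarrow> 'a) \<Rightarrow> 'a \<Rightarrow> 'a"
  where "A_adj A T = mp_inverse A \<circ> cadjoint T \<circ> A"

text \<open>The two suprema are taken in \<open>[0, \<infinity>)\<close>. Inserting \<open>0\<close> only matters for \<open>A = 0\<close>, where no
  vector has \<open>A\<close>-norm \<open>1\<close> and the supremum of the empty set is \<open>0\<close>; the real number \<open>Sup {}\<close> is
  unspecified. On operators with unbounded values the real supremum is also unspecified.\<close>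

definition A_opnorm :: "('a::chilbert_space \<Rightarrow> 'a) \<Rightarrow> ('a \<Rightarrow> 'a) \<Rightarrow> real"
  where "A_opnorm A T = Sup (insert 0 {A_norm A (T x) | x. A_norm A x = 1})"

definition A_numrad :: "('a::chilbert_space \<Rightarrow> 'a) \<Rightarrow> ('a \<Rightarrow> 'a) \<Rightarrow> real"
  where "A_numrad A T = Sup (insert 0 {cmod (A_inner A (T x) x) | x. A_norm A x = 1})"

end

theory Submission
  imports Defs
begin

text \<open>
  Write \<open>P = T\<^sup>\<sharp>T\<close>, \<open>Q = S\<^sup>\<sharp>S\<close>, \<open>N\<close> for the seminorm of \<open>P\<^sup>2 + Q\<^sup>2\<close>, \<open>w\<close> for the numerical radius of
  \<open>S\<^sup>\<sharp>T\<close>, and \<open>m\<close> for the product of the seminorms of \<open>T\<close> and \<open>S\<close>. For a vector \<open>x\<close> of seminorm 1 let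
  \<open>u\<close> and \<open>v\<close> be the seminorms of \<open>T x\<close> and \<open>S x\<close>. The square of the seminorm of \<open>T x + S x\<close> is
  \<open>u\<^sup>2 + v\<^sup>2 + 2 Re \<langle>T x, S x\<rangle>\<close>, and the last inner product has modulus at most \<open>w\<close>, since it is
  \<open>\<langle>S\<^sup>\<sharp>T x, x\<rangle>\<close>. By Cauchy-Schwarz \<open>u\<^sup>4 + v\<^sup>4 \<le> \<langle>(P\<^sup>2 + Q\<^sup>2) x, x\<rangle> \<le> N\<close>, and also \<open>u v \<le> m\<close>, \<open>w \<le> m\<close>.
  These bounds give \<open>u\<^sup>2 + v\<^sup>2 \<le> sqrt (N + 2 w\<^sup>2) + (m - w)\<close>, which is the numerical heart of the
  proof (lemma \<open>sum_squares_le_sqrt\<close>). Adding \<open>2 w\<close> yields the bound for \<open>\<alpha> = 0\<close>, the strongest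
  case: the right-hand side increases with \<open>\<alpha>\<close> because \<open>w \<le> m\<close>.

  The suprema must be finite for any of this to make sense, and that is where the hypothesis on the
  ranges enters. It makes \<open>A T\<^sup>\<sharp> = T\<^sup>* A\<close> hold everywhere (lemma \<open>A_adj_solves\<close>; adjoints come from the
  Riesz representation theorem and the value of the Moore-Penrose inverse on the range of \<open>A\<close> from
  orthogonal projection onto the kernel). The uniform boundedness principle then gives
  \<open>norm (A (T v)) \<le> C * norm (A v)\<close>. So \<open>R = T\<^sup>\<sharp>T\<close>, which is symmetric for the semi-inner product,
  satisfies an estimate of the same kind, and the estimate is carried over to the seminorm by
  iterating Cauchy-Schwarz along the powers of \<open>R\<close> (lemma \<open>A_symmetric_bound\<close>).
\<close>

section \<open>Elementary Hilbert space geometry\<close>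

lemma cinner_add_right:
  "cinner x (y + z) = cinner x y + cinner (x::'a::chilbert_space) z"
  by (metis cinner_add_left cinner_commute complex_cnj_add)

lemma cinner_scaleC_right:
  "cinner x (scaleC c y) = cnj c * cinner (x::'a::chilbert_space) y"
  by (metis cinner_scaleC_left cinner_commute complex_cnj_mult)

lemma scaleC_minus_one: "scaleC (-1) x = - (x::'a::chilbert_space)"
  using scaleR_scaleC[of "-1" x] by simp

lemma scaleC_zero_right: "scaleC c 0 = (0::'a::chilbert_space)"
  using scaleC_add_right[of c 0 "0::'a"] by simp

lemma cinner_minus_left: "cinner (- x) y = - cinner (x::'a::chilbert_space) y"
  using cinner_scaleC_left[of "-1" x y] by (simp add: scaleC_minus_one)

lemma cinner_minus_right: "cinner x (- y) = - cinner (x::'a::chilbert_space) y"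
  using cinner_scaleC_right[of x "-1" y] by (simp add: scaleC_minus_one)

lemma cinner_diff_left: "cinner (x - y) z = cinner x z - cinner (y::'a::chilbert_space) z"
  by (simp only: diff_conv_add_uminus cinner_add_left cinner_minus_left)

lemma cinner_diff_right: "cinner x (y - z) = cinner x y - cinner (x::'a::chilbert_space) z"
  by (simp only: diff_conv_add_uminus cinner_add_right cinner_minus_right)

lemma cinner_zero_left: "cinner 0 y = (0::complex)"
  using cinner_diff_left[of y y y] by simp

lemma cinner_zero_right: "cinner y 0 = (0::complex)"
  using cinner_diff_right[of y y y] by simp

lemma cinner_scaleR_left:
  "cinner (scaleR r x) y = complex_of_real r * cinner (x::'a::chilbert_space) y"
  by (simp add: scaleR_scaleC cinner_scaleC_left)

lemma norm_sq_cinner: "(norm (x::'a::chilbert_space))\<^sup>2 = Re (cinner x x)"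
  by (simp add: cinner_self)

lemma cinner_self_eq_0: "cinner x x = 0 \<longleftrightarrow> x = (0::'a::chilbert_space)"
  by (simp add: cinner_self)

text \<open>Adjoints are additive, homogeneous and unique because of this principle.\<close>

lemma cinner_right_ext:
  assumes "\<And>x. cinner x y = cinner (x::'a::chilbert_space) z"
  shows "y = z"
  using assms[of "y - z"] by (metis cinner_diff_right cinner_self_eq_0 right_minus_eq)

lemma parallelogram_law:
  "(norm (x + y))\<^sup>2 + (norm (x - y))\<^sup>2 = 2 * (norm x)\<^sup>2 + 2 * (norm (y::'a::chilbert_space))\<^sup>2"
  by (simp add: norm_sq_cinner cinner_add_left cinner_add_right cinner_diff_left cinner_diff_right)

section \<open>The semi-inner product of a positive operator\<close>

lemma bounded_clinearD:
  assumes "bounded_clinear T"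
  shows "T (x + y) = T x + T y" "T (x - y) = T x - T y" "T 0 = 0" "T (scaleC c x) = scaleC c (T x)"
    "bounded_linear T"
  using assms unfolding bounded_clinear_def
  by (auto simp: linear_simps)

text \<open>Over the complex numbers a real quadratic form forces symmetry: polarization with \<open>x + y\<close> gives
  the imaginary part and polarization with \<open>x + \<i> y\<close> the real part.\<close>

lemma positive_op_selfadjoint:
  assumes "positive_op A"
  shows "cinner (A x) y = cinner x (A y)"
proof -
  have lin: "bounded_clinear A" and im: "Im (cinner (A z) z) = 0" for z
    using assms unfolding positive_op_def by (auto simp: complex_nonneg_Reals_iff)
  note simps = bounded_clinearD[OF lin] cinner_add_left cinner_add_right
    cinner_scaleC_left cinner_scaleC_right
  have "Im (cinner (A x) y) = - Im (cinner (A y) x)"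
    using im[of "x + y"] im[of x] im[of y] by (simp add: simps)
  moreover have "Re (cinner (A x) y) = Re (cinner (A y) x)"
    using im[of "x + scaleC \<i> y"] im[of x] im[of y] by (simp add: simps)
  ultimately have "cinner (A x) y = cnj (cinner (A y) x)"
    by (simp add: complex_eq_iff)
  then show ?thesis
    by (metis cinner_commute)
qed

text \<open>With the identity as positive operator, every fact about the seminorm specializes to the Hilbert
  space norm; the ordinary Cauchy-Schwarz inequality is obtained in this way.\<close>

lemma positive_op_id: "positive_op (\<lambda>x. x)"
  by (auto simp: positive_op_def bounded_clinear_def bounded_linear_ident cinner_self
      complex_nonneg_Reals_iff)

text \<open>Taking the vertex \<open>t = - c / b\<close> of the parabola suffices, but for \<open>b = 0\<close> the polynomial is linear
  and would take the value \<open>-1\<close> unless \<open>c = 0\<close>.\<close>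

lemma quadratic_nonneg_imp_discriminant:
  fixes a b c :: real
  assumes quad: "\<And>t. a + 2 * t * c + t\<^sup>2 * b \<ge> 0" and "b \<ge> 0"
  shows "c\<^sup>2 \<le> a * b"
proof (cases "b = 0")
  case True
  have "c = 0"
  proof (rule ccontr)
    assume "c \<noteq> 0"
    then show False
      using quad[of "-(a + 1) / (2 * c)"] True by (simp add: field_simps)
  qed
  then show ?thesis using True by simp
next
  case False
  then have "a - c\<^sup>2 / b \<ge> 0"
    using quad[of "- c / b"] \<open>b \<ge> 0\<close> by (simp add: field_simps power2_eq_square)
  then show ?thesis using False \<open>b \<ge> 0\<close> by (simp add: field_simps)
qed

context
  fixes A :: "'a::chilbert_space \<Rightarrow> 'a"
  assumes pos: "positive_op A"
begin

lemma lin_A: "bounded_clinear A"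
  using pos unfolding positive_op_def by auto

lemma A_inner_add_left: "A_inner A (x + y) z = A_inner A x z + A_inner A y z"
  by (simp add: A_inner_def bounded_clinearD[OF lin_A] cinner_add_left)

lemma A_inner_add_right: "A_inner A x (y + z) = A_inner A x y + A_inner A x z"
  by (simp add: A_inner_def cinner_add_right)

lemma A_inner_commute: "A_inner A x y = cnj (A_inner A y x)"
  by (metis A_inner_def cinner_commute positive_op_selfadjoint[OF pos])

lemma A_inner_scaleC_left: "A_inner A (scaleC c x) y = c * A_inner A x y"
  by (simp add: A_inner_def bounded_clinearD[OF lin_A] cinner_scaleC_left)

lemma A_inner_scaleC_right: "A_inner A x (scaleC c y) = cnj c * A_inner A x y"
  by (simp add: A_inner_def cinner_scaleC_right)

lemma A_inner_self: "A_inner A x x = complex_of_real ((A_norm A x)\<^sup>2)"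
  using pos unfolding positive_op_def A_norm_def A_inner_def
  by (auto simp: complex_nonneg_Reals_iff complex_eq_iff)

lemma A_norm_nonneg: "A_norm A x \<ge> 0"
  using pos unfolding positive_op_def A_norm_def A_inner_def
  by (auto simp: complex_nonneg_Reals_iff)

lemma A_norm_sq: "(A_norm A x)\<^sup>2 = cmod (A_inner A x x)"
  unfolding A_inner_self norm_of_real by simp

lemma A_norm_add_sq:
  "(A_norm A (x + y))\<^sup>2 = (A_norm A x)\<^sup>2 + (A_norm A y)\<^sup>2 + 2 * Re (A_inner A x y)"
proof -
  have "complex_of_real ((A_norm A (x + y))\<^sup>2)
      = complex_of_real ((A_norm A x)\<^sup>2) + complex_of_real ((A_norm A y)\<^sup>2)
        + (A_inner A x y + cnj (A_inner A x y))"
    by (simp only: A_inner_self[symmetric] A_inner_add_left A_inner_add_right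
        A_inner_commute[of y x] add_ac)
  then show ?thesis
    by (simp add: complex_eq_iff)
qed

text \<open>Rotating \<open>y\<close> by the phase of \<open>\<langle>x, y\<rangle>\<close> makes the cross term real, so that a real quadratic
  polynomial in \<open>t\<close> carries the full modulus. The discriminant argument also covers vectors \<open>y\<close> of
  seminorm 0, by which one could not divide.\<close>

lemma A_cauchy_schwarz: "cmod (A_inner A x y) \<le> A_norm A x * A_norm A y"
proof -
  let ?c = "A_inner A x y"
  define u where "u = (if ?c = 0 then 1 else ?c / cmod ?c)"
  have u: "cmod u = 1" "cnj u * ?c = cmod ?c"
    by (auto simp: u_def norm_divide complex_norm_square[symmetric] power2_eq_square mult.commute
        field_simps)
  have "(A_norm A x)\<^sup>2 + 2 * t * cmod ?c + t\<^sup>2 * (A_norm A y)\<^sup>2 \<ge> 0" for t :: real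
  proof -
    let ?z = "scaleC (of_real t * u) y"
    have "A_inner A ?z ?z = of_real (t\<^sup>2) * (u * cnj u) * A_inner A y y"
      by (simp add: A_inner_scaleC_left A_inner_scaleC_right power2_eq_square)
    also have "u * cnj u = 1"
      using u(1) by (simp add: complex_norm_square[symmetric])
    finally have "(A_norm A ?z)\<^sup>2 = t\<^sup>2 * (A_norm A y)\<^sup>2"
      unfolding A_inner_self by (metis mult.right_neutral of_real_eq_iff of_real_mult)
    moreover have "A_inner A x ?z = of_real (t * cmod ?c)"
      using u(2) by (simp add: A_inner_scaleC_right mult.assoc)
    ultimately have "(A_norm A (x + ?z))\<^sup>2
        = (A_norm A x)\<^sup>2 + 2 * t * cmod ?c + t\<^sup>2 * (A_norm A y)\<^sup>2"
      by (simp add: A_norm_add_sq)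
    then show ?thesis
      by (metis zero_le_power2)
  qed
  then have "(cmod ?c)\<^sup>2 \<le> (A_norm A x)\<^sup>2 * (A_norm A y)\<^sup>2"
    by (rule quadratic_nonneg_imp_discriminant) simp
  then have "(cmod ?c)\<^sup>2 \<le> (A_norm A x * A_norm A y)\<^sup>2"
    by (simp add: power_mult_distrib)
  then show ?thesis
    by (rule power2_le_imp_le) (simp add: A_norm_nonneg)
qed

lemma A_norm_triangle: "A_norm A (x + y) \<le> A_norm A x + A_norm A y"
proof (rule power2_le_imp_le)
  have "Re (A_inner A x y) \<le> A_norm A x * A_norm A y"
    using A_cauchy_schwarz complex_Re_le_cmod order_trans by blast
  then show "(A_norm A (x + y))\<^sup>2 \<le> (A_norm A x + A_norm A y)\<^sup>2"
    unfolding A_norm_add_sq by (simp add: power2_sum)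
qed (simp add: A_norm_nonneg)

end

lemma cauchy_schwarz: "cmod (cinner x y) \<le> norm x * norm (y::'a::chilbert_space)"
  using A_cauchy_schwarz[OF positive_op_id, of x y]
  by (simp add: A_inner_def A_norm_def cinner_self)

lemma bounded_linear_cinner_left: "bounded_linear (\<lambda>x. cinner x (y::'a::chilbert_space))"
proof (rule bounded_linear_intro)
  show "cinner (scaleR r x) y = scaleR r (cinner x y)" for r x
    by (simp add: cinner_scaleR_left scaleR_conv_of_real)
  show "norm (cinner x y) \<le> norm x * norm y" for x
    by (rule cauchy_schwarz)
qed (rule cinner_add_left)

section \<open>Orthogonal projection, Riesz representation and adjoints\<close>

text \<open>A minimizing sequence is Cauchy by the parallelogram law, and completeness gives its limit.\<close>

lemma nearest_point_subspace:
  fixes N :: "'a::chilbert_space set"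
  assumes clo: "closed N" and zero: "0 \<in> N"
    and add: "\<And>x y. x \<in> N \<Longrightarrow> y \<in> N \<Longrightarrow> x + y \<in> N"
    and scale: "\<And>c x. x \<in> N \<Longrightarrow> scaleC c x \<in> N"
  obtains n where "n \<in> N" "\<And>k. k \<in> N \<Longrightarrow> norm (z - n) \<le> norm (z - k)"
proof -
  define d where "d = (INF k\<in>N. (norm (z - k))\<^sup>2)"
  have bdd: "bdd_below ((\<lambda>k. (norm (z - k))\<^sup>2) ` N)"
    by (rule bdd_belowI2[of _ 0]) auto
  have d_le: "d \<le> (norm (z - k))\<^sup>2" if "k \<in> N" for k
    unfolding d_def using bdd that by (rule cINF_lower)
  have "\<exists>k\<in>N. (norm (z - k))\<^sup>2 < d + inverse (real (Suc i))" for i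
    using cINF_less_iff[OF _ bdd, of "d + inverse (real (Suc i))"] zero
    unfolding d_def[symmetric] by auto
  then obtain x where xN: "\<And>i. x i \<in> N"
    and x: "\<And>i. (norm (z - x i))\<^sup>2 < d + inverse (real (Suc i))"
    by metis
  have x_close: "(norm (x i - x j))\<^sup>2 \<le> 2 * inverse (real (Suc i)) + 2 * inverse (real (Suc j))"
    for i j
  proof -
    \<comment> \<open>The midpoint of two almost nearest points lies in \<open>N\<close>, hence is not nearer than \<open>d\<close>.\<close>
    let ?m = "scaleR (1/2) (x i + x j)"
    have "?m \<in> N"
      using add scale xN by (simp add: scaleR_scaleC)
    moreover have "(z - x i) + (z - x j) = scaleR 2 (z - ?m)"
      by (simp add: algebra_simps scaleR_2)
    ultimately have sum: "(norm ((z - x i) + (z - x j)))\<^sup>2 \<ge> 4 * d"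
      using d_le[of ?m] by (simp add: power_mult_distrib)
    have "(z - x i) - (z - x j) = - (x i - x j)" by simp
    then have diff: "norm ((z - x i) - (z - x j)) = norm (x i - x j)"
      by (metis norm_minus_cancel)
    show ?thesis
      using sum parallelogram_law[of "z - x i" "z - x j"] x[of i] x[of j]
      unfolding diff by linarith
  qed
  have "Cauchy x"
  proof (rule metric_CauchyI)
    fix e :: real assume "0 < e"
    then obtain M where M: "inverse (real (Suc M)) < e\<^sup>2 / 4"
      using reals_Archimedean[of "e\<^sup>2 / 4"] by auto
    have "dist (x i) (x j) < e" if "i \<ge> M" "j \<ge> M" for i j
    proof -
      have "inverse (real (Suc i)) \<le> inverse (real (Suc M))"
        "inverse (real (Suc j)) \<le> inverse (real (Suc M))"
        using that by (auto intro!: le_imp_inverse_le)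
      then have "(norm (x i - x j))\<^sup>2 < e\<^sup>2"
        using x_close[of i j] M by linarith
      then show ?thesis
        using \<open>0 < e\<close> by (simp add: dist_norm power2_less_imp_less)
    qed
    then show "\<exists>M. \<forall>m\<ge>M. \<forall>n\<ge>M. dist (x m) (x n) < e" by blast
  qed
  then obtain n where lim: "x \<longlonglongrightarrow> n"
    using Cauchy_convergent convergent_def by blast
  have "n \<in> N"
    using clo xN lim closed_sequentially by blast
  have "(norm (z - n))\<^sup>2 \<le> d + 0"
  proof (rule LIMSEQ_le)
    show "(\<lambda>i. (norm (z - x i))\<^sup>2) \<longlonglongrightarrow> (norm (z - n))\<^sup>2"
      by (intro tendsto_intros lim)
    show "(\<lambda>i. d + inverse (real (Suc i))) \<longlonglongrightarrow> d + 0"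
      by (intro tendsto_intros LIMSEQ_inverse_real_of_nat)
    show "\<exists>M. \<forall>i\<ge>M. (norm (z - x i))\<^sup>2 \<le> d + inverse (real (Suc i))"
      using x less_imp_le by blast
  qed
  then have "(norm (z - n))\<^sup>2 \<le> (norm (z - k))\<^sup>2" if "k \<in> N" for k
    using d_le[OF that] by linarith
  then have "norm (z - n) \<le> norm (z - k)" if "k \<in> N" for k
    using power2_le_imp_le[OF _ norm_ge_zero] that by blast
  with \<open>n \<in> N\<close> show ?thesis using that by blast
qed

text \<open>The nearest point is the foot of the perpendicular: if \<open>e = z - n\<close> were not orthogonal to some \<open>k\<close>
  in \<open>N\<close>, then removing from \<open>e\<close> its component along \<open>k\<close> would bring \<open>z\<close> closer to \<open>N\<close>.\<close>

lemma orthogonal_decomposition: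
  fixes N :: "'a::chilbert_space set"
  assumes clo: "closed N" and zero: "0 \<in> N"
    and add: "\<And>x y. x \<in> N \<Longrightarrow> y \<in> N \<Longrightarrow> x + y \<in> N"
    and scale: "\<And>c x. x \<in> N \<Longrightarrow> scaleC c x \<in> N"
  obtains n where "n \<in> N" "z - n \<in> orth_compl N"
proof -
  obtain n where n: "n \<in> N" "\<And>k. k \<in> N \<Longrightarrow> norm (z - n) \<le> norm (z - k)"
    using nearest_point_subspace[OF assms] by metis
  have "cinner (z - n) k = 0" if "k \<in> N" for k
  proof (cases "k = 0")
    case True
    then show ?thesis by (simp add: cinner_zero_right)
  next
    case False
    define e where "e = z - n"
    define c where "c = cinner e k / of_real ((norm k)\<^sup>2)"
    have ck: "cnj c * cinner e k = of_real ((cmod (cinner e k))\<^sup>2 / (norm k)\<^sup>2)"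
      using complex_norm_square[of "cinner e k"] by (simp add: c_def mult.commute)
    have kk: "c * cinner k k = cinner e k"
      using False by (simp add: c_def cinner_self)
    have "cinner (e - scaleC c k) (e - scaleC c k)
        = cinner e e - cnj c * cinner e k - c * cinner k e + cnj c * (c * cinner k k)"
      by (simp add: cinner_diff_left cinner_diff_right cinner_scaleC_left cinner_scaleC_right
          algebra_simps)
    also have "\<dots> = cinner e e - cnj (cnj c * cinner e k)"
      unfolding kk by (simp add: cinner_commute[of k e])
    finally have "(norm (e - scaleC c k))\<^sup>2 = (norm e)\<^sup>2 - (cmod (cinner e k))\<^sup>2 / (norm k)\<^sup>2"
      unfolding ck by (simp add: norm_sq_cinner)
    moreover have "norm e \<le> norm (e - scaleC c k)"
      using n(2)[OF add[OF n(1) scale[OF that]], of c] by (simp add: e_def algebra_simps)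
    then have "(norm e)\<^sup>2 \<le> (norm (e - scaleC c k))\<^sup>2"
      by (simp add: power_mono)
    ultimately have "(cmod (cinner e k))\<^sup>2 / (norm k)\<^sup>2 \<le> 0" by linarith
    then have "cinner e k = 0"
      using False by (simp add: divide_le_0_iff)
    then show ?thesis by (simp add: e_def)
  qed
  with n(1) show ?thesis
    using that by (auto simp: orth_compl_def)
qed

text \<open>A vector orthogonal to the kernel and outside it represents the functional up to a scalar, since
  the kernel has codimension one.\<close>

lemma riesz_representation:
  fixes L :: "'a::chilbert_space \<Rightarrow> complex"
  assumes lin: "bounded_linear L" and scale: "\<And>c x. L (scaleC c x) = c * L x"
  obtains z where "\<And>x. L x = cinner x z"
proof (cases "\<forall>x. L x = 0")
  case True
  then show ?thesis using that[of 0] by (simp add: cinner_zero_right)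
next
  case False
  then obtain x0 where x0: "L x0 \<noteq> 0" by auto
  interpret L: bounded_linear L by fact
  have "closed {x. L x = 0}"
    by (intro closed_Collect_eq L.continuous_on continuous_on_id continuous_on_const)
  then obtain n where n: "n \<in> {x. L x = 0}" "x0 - n \<in> orth_compl {x. L x = 0}"
    by (rule orthogonal_decomposition) (auto simp: L.add scale L.zero)
  define e where "e = x0 - n"
  have Le: "L e \<noteq> 0" using n x0 by (simp add: e_def L.diff)
  then have ne: "norm e \<noteq> 0" using L.zero by force
  have orth: "cinner k e = 0" if "L k = 0" for k
    using n(2) that cinner_commute[of k e] by (auto simp: orth_compl_def e_def)
  have "L x = cinner x (scaleC (cnj (L e) / of_real ((norm e)\<^sup>2)) e)" for x
  proof -
    have "L (x - scaleC (L x / L e) e) = 0"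
      using Le by (simp add: L.diff scale)
    from orth[OF this] have "cinner x e = L x / L e * of_real ((norm e)\<^sup>2)"
      by (simp add: cinner_diff_left cinner_scaleC_left cinner_self)
    then show ?thesis
      using Le ne by (simp add: cinner_scaleC_right)
  qed
  then show ?thesis using that by blast
qed

lemma adjoint_exists:
  fixes T :: "'a::chilbert_space \<Rightarrow> 'a"
  assumes T: "bounded_clinear T"
  shows "\<exists>S. bounded_clinear S \<and> (\<forall>x y. cinner (T x) y = cinner x (S y))"
proof -
  interpret T: bounded_linear T using T by (rule bounded_clinearD)
  have "\<exists>z. \<forall>x. cinner (T x) y = cinner x z" for y
    by (rule riesz_representation[of "\<lambda>x. cinner (T x) y"])
      (auto simp: bounded_clinearD[OF T] cinner_scaleC_left
        intro: bounded_linear_compose[OF bounded_linear_cinner_left T.bounded_linear_axioms])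
  then obtain S where S: "\<And>x y. cinner (T x) y = cinner x (S y)" by metis
  have add: "S (y + z) = S y + S z" for y z
    by (rule cinner_right_ext) (simp add: S[symmetric] cinner_add_right)
  have sc: "S (scaleC c y) = scaleC c (S y)" for c y
    by (rule cinner_right_ext) (simp add: S[symmetric] cinner_scaleC_right)
  obtain K where K: "\<And>x. norm (T x) \<le> norm x * K" "0 < K"
    using T.pos_bounded by blast
  have "norm (S y) \<le> norm y * K" for y
  proof (cases "S y = 0")
    case False
    have "(norm (S y))\<^sup>2 = Re (cinner (T (S y)) y)"
      by (simp add: S norm_sq_cinner)
    also have "\<dots> \<le> norm (T (S y)) * norm y"
      using complex_Re_le_cmod cauchy_schwarz order_trans by blast
    also have "\<dots> \<le> norm (S y) * K * norm y"
      by (intro mult_right_mono K) auto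
    finally show ?thesis
      using False by (simp add: power2_eq_square algebra_simps)
  qed (use K in simp)
  then have "bounded_linear S"
    by (intro bounded_linear_intro) (auto simp: add sc scaleR_scaleC)
  with S sc show ?thesis unfolding bounded_clinear_def by blast
qed

lemma cadjoint_works:
  fixes T :: "'a::chilbert_space \<Rightarrow> 'a"
  assumes "bounded_clinear T"
  shows "bounded_clinear (cadjoint T)" "cinner (T x) y = cinner x (cadjoint T y)"
proof -
  obtain S where S: "bounded_clinear S \<and> (\<forall>x y. cinner (T x) y = cinner x (S y))"
    using adjoint_exists[OF assms] by blast
  have "bounded_clinear (cadjoint T) \<and> (\<forall>x y. cinner (T x) y = cinner x (cadjoint T y))"
    unfolding cadjoint_def
  proof (rule theI[of "\<lambda>S. bounded_clinear S \<and> (\<forall>x y. cinner (T x) y = cinner x (S y))", OF S])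
    fix S' assume "bounded_clinear S' \<and> (\<forall>x y. cinner (T x) y = cinner x (S' y))"
    with S show "S' = S"
      by (metis cinner_right_ext ext)
  qed
  then show "bounded_clinear (cadjoint T)" "cinner (T x) y = cinner x (cadjoint T y)" by auto
qed

section \<open>The \<open>A\<close>-adjoint\<close>

text \<open>If \<open>y = A z\<close>, the part of \<open>z\<close> orthogonal to the kernel of \<open>A\<close> solves the equation. It is the only
  candidate: for another one the residual lies both in the range of \<open>A\<close> and in its orthogonal
  complement, so the difference of the two lies both in the kernel and in its orthogonal complement.\<close>

lemma mp_inverse_solves:
  fixes A :: "'a::chilbert_space \<Rightarrow> 'a"
  assumes A: "bounded_clinear A" and y: "y \<in> range A"
  shows "A (mp_inverse A y) = y"
proof -
  interpret A: bounded_linear A using A by (rule bounded_clinearD)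
  obtain z where z: "y = A z" using y by auto
  have "closed {x. A x = 0}"
    by (intro closed_Collect_eq A.continuous_on continuous_on_id continuous_on_const)
  then obtain n where n: "n \<in> {x. A x = 0}" "z - n \<in> orth_compl {x. A x = 0}"
    by (rule orthogonal_decomposition)
      (auto simp: bounded_clinearD[OF A] scaleC_zero_right)
  let ?P = "\<lambda>x. x \<in> orth_compl {z. A z = 0} \<and> y - A x \<in> orth_compl (range A)"
  have range_orth: "A u = 0" if "A u \<in> orth_compl (range A)" for u
  proof -
    have "cinner (A u) (A u) = 0" using that by (auto simp: orth_compl_def)
    then show ?thesis by (simp add: cinner_self_eq_0)
  qed
  have ex: "?P (z - n)"
    using n z by (auto simp: A.diff orth_compl_def cinner_zero_left)
  have uniq: "x = z - n" if "?P x" for x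
  proof -
    let ?v = "z - n - x"
    have "A (z - x) \<in> orth_compl (range A)"
      using that z by (simp add: A.diff)
    then have "A ?v = 0"
      using range_orth[of "z - x"] n(1) by (simp add: A.diff)
    then have "cinner ?v ?v = 0"
      using n(2) that by (auto simp: orth_compl_def cinner_diff_left[of "z - n" x])
    then show ?thesis by (simp add: cinner_self_eq_0)
  qed
  have "mp_inverse A y = z - n"
    unfolding mp_inverse_def using ex uniq by (rule the_equality)
  then show ?thesis using n z by (simp add: A.diff)
qed

text \<open>The range condition in \<open>A_adjointable\<close> says that \<open>T\<^sup>* A y\<close> always lies where \<open>mp_inverse A\<close> is a
  right inverse of \<open>A\<close>.\<close>

lemma A_adj_solves:
  assumes "positive_op A" and T: "T \<in> A_adjointable A"
  shows "A (A_adj A T y) = cadjoint T (A y)"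
  using mp_inverse_solves[OF lin_A[OF assms(1)], of "cadjoint T (A y)"] T
  by (auto simp: A_adjointable_def A_adj_def)

lemma A_inner_A_adj:
  assumes pos: "positive_op A" and T: "T \<in> A_adjointable A"
  shows "A_inner A (T x) y = A_inner A x (A_adj A T y)"
proof -
  have "bounded_clinear T" using T by (simp add: A_adjointable_def)
  then show ?thesis
    by (simp add: A_inner_def positive_op_selfadjoint[OF pos] A_adj_solves[OF assms]
        cadjoint_works)
qed

section \<open>Adjointable operators are bounded for the seminorm\<close>

text \<open>The Banach-Steinhaus theorem. The closed sets \<open>G n\<close> of points at which the family is bounded by
  \<open>n\<close> cover the space, so by Baire one of them contains a ball; differences of points of this ball
  bound the family on a ball around 0.\<close>

lemma uniform_boundedness:
  fixes F :: "('a::banach \<Rightarrow> 'b::real_normed_vector) set"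
  assumes lin: "\<And>f. f \<in> F \<Longrightarrow> bounded_linear f"
    and ptw: "\<And>x. \<exists>M. \<forall>f\<in>F. norm (f x) \<le> M"
  shows "\<exists>C\<ge>0. \<forall>f\<in>F. \<forall>x. norm (f x) \<le> C * norm x"
proof -
  define G where "G n = {x. \<forall>f\<in>F. norm (f x) \<le> real n}" for n
  have clo: "closed (G n)" for n
  proof -
    have "G n = (\<Inter>f\<in>F. {x. norm (f x) \<le> real n})" by (auto simp: G_def)
    moreover have "closed {x. norm (f x) \<le> real n}" if "f \<in> F" for f
      by (intro closed_Collect_le continuous_on_norm continuous_on_const
          linear_continuous_on[OF lin[OF that]])
    ultimately show ?thesis by auto
  qed
  have "\<exists>n. interior (G n) \<noteq> {}"
  proof (rule ccontr)
    assume *: "\<nexists>n. interior (G n) \<noteq> {}"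
    have "euclidean interior_of (\<Union>(range G)) = {}"
      by (rule Baire_category_alt) (use clo * in \<open>auto simp: completely_metrizable_space_euclidean\<close>)
    moreover have "\<Union>(range G) = UNIV"
    proof -
      have "\<exists>n. x \<in> G n" for x
      proof -
        obtain M where M: "\<And>f. f \<in> F \<Longrightarrow> norm (f x) \<le> M" using ptw by blast
        obtain n where "M \<le> real n" using real_arch_simple by blast
        then have "\<forall>f\<in>F. norm (f x) \<le> real n" using M order_trans by blast
        then show ?thesis by (auto simp: G_def)
      qed
      then show ?thesis by auto
    qed
    ultimately show False by simp
  qed
  then obtain n x0 where "x0 \<in> interior (G n)" by auto
  then obtain r where r: "r > 0" "cball x0 r \<subseteq> G n"
    using mem_interior_cball by blast
  have bnd: "norm (f x) \<le> (2 * real n / r) * norm x" if f: "f \<in> F" for f x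
  proof (cases "x = 0")
    case True
    interpret bounded_linear f using lin f by auto
    show ?thesis using True zero by simp
  next
    case False
    interpret bounded_linear f using lin f by auto
    define h where "h = scaleR (r / norm x) x"
    have "norm h = r" using r False by (simp add: h_def)
    then have "x0 \<in> G n" "x0 + h \<in> G n"
      using r by (auto intro!: subsetD[OF r(2)] simp: dist_norm)
    then have "norm (f x0) \<le> n" "norm (f (x0 + h)) \<le> n"
      using f by (auto simp: G_def)
    then have "norm (f h) \<le> 2 * real n"
      using norm_triangle_ineq4[of "f (x0 + h)" "f x0"] by (simp add: add)
    then have "(r / norm x) * norm (f x) \<le> 2 * real n"
      using r by (simp add: h_def scaleR)
    then show ?thesis using r False by (simp add: field_simps)
  qed
  show ?thesis
    using bnd r(1) by (intro exI[of _ "2 * real n / r"]) auto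
qed

text \<open>Up to conjugation \<open>\<langle>y, A T v\<rangle>\<close> is \<open>\<langle>A v, T\<^sup>\<sharp> y\<rangle>\<close>. Hence the functionals \<open>y \<mapsto> \<langle>y, A T v\<rangle>\<close>, divided by
  the norm of \<open>A v\<close>, are bounded at each \<open>y\<close> by the norm of \<open>T\<^sup>\<sharp> y\<close>, and the uniform boundedness
  principle provides \<open>C\<close>. Evaluation at \<open>y = A T v\<close> gives the claim.\<close>

lemma A_adjointable_graph_bound:
  assumes pos: "positive_op A" and T: "T \<in> A_adjointable A"
  obtains C where "C \<ge> 0" "\<And>v. norm (A (T v)) \<le> C * norm (A v)"
proof -
  have key: "cmod (cinner y (A (T v))) \<le> norm (A v) * norm (A_adj A T y)" for y v
  proof -
    have "cinner y (A (T v)) = cnj (cinner (A v) (A_adj A T y))"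
      using A_inner_A_adj[OF assms, of v y] cinner_commute unfolding A_inner_def by metis
    then show ?thesis
      using cauchy_schwarz[of "A v" "A_adj A T y"] by simp
  qed
  \<comment> \<open>As \<open>inverse 0 = 0\<close>, the functional is 0 when \<open>A v = 0\<close>; the final case distinction treats
    these vectors directly through \<open>key\<close>.\<close>
  define f where "f v y = scaleR (inverse (norm (A v))) (cinner y (A (T v)))" for v y
  have ptw: "\<exists>M. \<forall>g\<in>range f. norm (g y) \<le> M" for y
  proof (intro exI ballI)
    fix g assume "g \<in> range f"
    then obtain v where g: "g = f v" by auto
    show "norm (g y) \<le> norm (A_adj A T y)"
      using key[of y v] by (cases "A v = 0") (auto simp: g f_def field_simps)
  qed
  have "bounded_linear (f v)" for v
    unfolding f_def
    by (rule bounded_linear_compose[OF bounded_linear_scaleR_right bounded_linear_cinner_left])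
  then have lin: "bounded_linear g" if "g \<in> range f" for g
    using that by auto
  obtain C where C: "C \<ge> 0" "\<And>v y. norm (f v y) \<le> C * norm y"
    using uniform_boundedness[of "range f", OF lin ptw] by auto
  have "norm (A (T v)) \<le> C * norm (A v)" for v
  proof (cases "A v = 0 \<or> A (T v) = 0")
    case True
    then have "A (T v) = 0"
      using key[of "A (T v)" v] by (auto simp: cinner_self)
    then show ?thesis using C by simp
  next
    case False
    have "inverse (norm (A v)) * (norm (A (T v)))\<^sup>2 \<le> C * norm (A (T v))"
      using C(2)[of v "A (T v)"] by (simp add: f_def cinner_self norm_power)
    then show ?thesis
      using False by (simp add: field_simps power2_eq_square)
  qed
  with C(1) show ?thesis using that by blast
qed

text \<open>A fixed constant \<open>K\<close> cannot compensate for a larger growth rate.\<close>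

lemma power_growth_le:
  fixes r d c K :: real
  assumes "\<And>k. r ^ k * c \<le> d ^ k * K" "c > 0" "d \<ge> 0"
  shows "r \<le> d"
proof (rule ccontr)
  assume "\<not> r \<le> d"
  then have r: "r > d" "r > 0" using assms(3) by auto
  have "c \<le> (d / r) ^ k * K" for k
    using assms(1)[of k] r by (simp add: power_divide field_simps)
  moreover have "(\<lambda>k. (d / r) ^ k * K) \<longlonglongrightarrow> 0 * K"
    using r assms(3) by (intro tendsto_mult tendsto_const LIMSEQ_realpow_zero) auto
  ultimately have "c \<le> 0 * K"
    by (intro LIMSEQ_le_const) auto
  then show False using assms(2) by simp
qed

text \<open>Krein's argument for operators that are symmetric for a weaker inner product. By symmetry and
  Cauchy-Schwarz the seminorms \<open>q k\<close> of \<open>R\<^sup>k x\<close> form a log-convex sequence, so they grow at least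
  like the powers of \<open>q 1 / q 0\<close>. On the other hand \<open>(q k)\<^sup>2 = \<langle>A R\<^bsup>2k\<^esup> x, x\<rangle>\<close> is at most a constant
  times \<open>D\<^bsup>2k\<^esup>\<close>, hence \<open>q 1 / q 0 \<le> D\<close>.\<close>

lemma A_symmetric_bound:
  assumes pos: "positive_op A"
    and sym: "\<And>x y. A_inner A (R x) y = A_inner A x (R y)"
    and D: "D \<ge> 0" "\<And>x. norm (A (R x)) \<le> D * norm (A x)"
  shows "A_norm A (R x) \<le> D * A_norm A x"
proof -
  define q where "q k = A_norm A ((R ^^ k) x)" for k
  have q0: "q k \<ge> 0" for k by (simp add: q_def A_norm_nonneg[OF pos])
  have logconvex: "(q (Suc k))\<^sup>2 \<le> q k * q (Suc (Suc k))" for k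
  proof -
    have "(q (Suc k))\<^sup>2 = cmod (A_inner A ((R ^^ k) x) ((R ^^ Suc (Suc k)) x))"
      by (simp add: q_def A_norm_sq[OF pos] sym)
    then show ?thesis
      unfolding q_def using A_cauchy_schwarz[OF pos] by simp
  qed
  have sym_pow: "A_inner A ((R ^^ k) u) y = A_inner A u ((R ^^ k) y)" for k u y
    by (induction k arbitrary: y) (simp_all add: sym funpow_swap1[symmetric])
  have D_pow: "norm (A ((R ^^ k) x)) \<le> D ^ k * norm (A x)" for k
  proof (induction k)
    case (Suc k)
    have "norm (A ((R ^^ Suc k) x)) \<le> D * norm (A ((R ^^ k) x))"
      using D(2) by simp
    also have "\<dots> \<le> D * (D ^ k * norm (A x))"
      using Suc D(1) by (rule mult_left_mono)
    finally show ?case by (simp add: mult.assoc)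
  qed simp
  have growth: "(q k)\<^sup>2 \<le> (D\<^sup>2) ^ k * (norm (A x) * norm x)" for k
  proof -
    have "(q k)\<^sup>2 = cmod (A_inner A ((R ^^ (k + k)) x) x)"
      by (simp add: q_def A_norm_sq[OF pos] sym_pow funpow_add)
    then have "(q k)\<^sup>2 = cmod (cinner (A ((R ^^ (k + k)) x)) x)"
      by (simp only: A_inner_def)
    also have "\<dots> \<le> norm (A ((R ^^ (k + k)) x)) * norm x"
      by (rule cauchy_schwarz)
    also have "\<dots> \<le> D ^ (k + k) * norm (A x) * norm x"
      by (intro mult_right_mono D_pow) auto
    finally show ?thesis
      by (simp add: power_mult[symmetric] mult_2 mult.assoc)
  qed
  show ?thesis
  proof (cases "q 1 = 0 \<or> q 0 = 0")
    case True
    then have "q 1 = 0" using logconvex[of 0] by auto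
    then show ?thesis
      using q0[of 0] D(1) by (simp add: q_def)
  next
    case False
    then have pos0: "q 0 > 0" and pos1: "q 1 > 0" using q0[of 0] q0[of 1] by auto
    define r where "r = q 1 / q 0"
    have rpos: "r > 0" using pos0 pos1 by (simp add: r_def)
    have step: "q k > 0 \<and> q (Suc k) \<ge> r * q k" for k
    proof (induction k)
      case 0
      then show ?case using pos0 by (simp add: r_def)
    next
      case (Suc k)
      then have p: "q (Suc k) > 0"
        using rpos by (meson less_le_trans mult_pos_pos)
      have "r * q (Suc k) * q k \<le> q (Suc k) * q (Suc k)"
        using mult_right_mono[of "r * q k" "q (Suc k)" "q (Suc k)"] Suc p
        by (simp add: algebra_simps)
      also have "\<dots> \<le> q (Suc (Suc k)) * q k"
        using logconvex[of k] by (simp add: power2_eq_square mult.commute)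
      finally show ?case using Suc p by simp
    qed
    have low: "r ^ k * q 0 \<le> q k" for k
    proof (induction k)
      case (Suc k)
      have "r ^ Suc k * q 0 \<le> r * q k"
        using Suc rpos by (simp add: mult.assoc)
      then show ?case using step[of k] by linarith
    qed simp
    \<comment> \<open>Both growth estimates are compared in squared form, as the upper one only bounds \<open>(q k)\<^sup>2\<close>.\<close>
    have "(r\<^sup>2) ^ k * (q 0)\<^sup>2 \<le> (D\<^sup>2) ^ k * (norm (A x) * norm x)" for k
    proof -
      have "(r ^ k * q 0)\<^sup>2 \<le> (q k)\<^sup>2"
        using low rpos pos0 by (intro power_mono) auto
      then show ?thesis
        using growth[of k] by (simp add: power_mult_distrib power_mult[symmetric] mult.commute)
    qed
    then have "r\<^sup>2 \<le> D\<^sup>2"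
      by (rule power_growth_le) (use pos0 in auto)
    then have "r \<le> D" using D(1) by (rule power2_le_imp_le)
    then show ?thesis
      using pos0 by (simp add: r_def q_def field_simps)
  qed
qed

definition A_bounded :: "('a::chilbert_space \<Rightarrow> 'a) \<Rightarrow> ('a \<Rightarrow> 'a) \<Rightarrow> bool"
  where "A_bounded A T \<longleftrightarrow> (\<exists>c\<ge>0. \<forall>x. A_norm A (T x) \<le> c * A_norm A x)"

lemma A_inner_gram:
  assumes pos: "positive_op A" and T: "T \<in> A_adjointable A"
  shows "A_inner A ((A_adj A T \<circ> T) x) y = A_inner A (T x) (T y)"
    and "A_inner A x ((A_adj A T \<circ> T) y) = A_inner A (T x) (T y)"
  using A_inner_A_adj[OF assms] A_inner_commute[OF pos] by (metis comp_apply)+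

lemma A_bounded_gram:
  assumes pos: "positive_op A" and T: "T \<in> A_adjointable A"
  shows "A_bounded A (A_adj A T \<circ> T)"
proof -
  have "bounded_clinear T" using T by (simp add: A_adjointable_def)
  then have "bounded_linear (cadjoint T)"
    using cadjoint_works(1) bounded_clinearD(5) by blast
  then obtain K where K: "K > 0" "\<And>x. norm (cadjoint T x) \<le> norm x * K"
    using bounded_linear.pos_bounded by blast
  obtain C where C: "C \<ge> 0" "\<And>v. norm (A (T v)) \<le> C * norm (A v)"
    using A_adjointable_graph_bound[OF assms] by blast
  have "norm (A ((A_adj A T \<circ> T) x)) \<le> (K * C) * norm (A x)" for x
  proof -
    have "norm (A ((A_adj A T \<circ> T) x)) \<le> norm (A (T x)) * K"
      using K(2) by (simp add: A_adj_solves[OF assms])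
    also have "\<dots> \<le> C * norm (A x) * K"
      using C(2) K(1) by (intro mult_right_mono) auto
    finally show ?thesis by (simp add: algebra_simps)
  qed
  then have "A_norm A ((A_adj A T \<circ> T) x) \<le> (K * C) * A_norm A x" for x
    using K C by (intro A_symmetric_bound[OF pos]) (auto simp: A_inner_gram[OF assms, unfolded comp_apply])
  then show ?thesis
    unfolding A_bounded_def using K C by (intro exI[of _ "K * C"]) auto
qed

text \<open>The square of the seminorm of \<open>T x\<close> is \<open>\<langle>T\<^sup>\<sharp>T x, x\<rangle>\<close>, so the bound for \<open>T\<^sup>\<sharp>T\<close> passes to \<open>T\<close>.\<close>

lemma A_bounded_adjointable:
  assumes pos: "positive_op A" and T: "T \<in> A_adjointable A"
  shows "A_bounded A T"
proof -
  obtain c where c: "c \<ge> 0" "\<And>x. A_norm A ((A_adj A T \<circ> T) x) \<le> c * A_norm A x"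
    using A_bounded_gram[OF assms] unfolding A_bounded_def by blast
  have "A_norm A (T x) \<le> sqrt c * A_norm A x" for x
  proof (rule power2_le_imp_le)
    have "(A_norm A (T x))\<^sup>2 = cmod (A_inner A ((A_adj A T \<circ> T) x) x)"
      by (simp only: A_norm_sq[OF pos] A_inner_gram[OF assms])
    also have "\<dots> \<le> A_norm A ((A_adj A T \<circ> T) x) * A_norm A x"
      by (rule A_cauchy_schwarz[OF pos])
    also have "\<dots> \<le> c * A_norm A x * A_norm A x"
      using c(2) by (intro mult_right_mono A_norm_nonneg[OF pos])
    finally show "(A_norm A (T x))\<^sup>2 \<le> (sqrt c * A_norm A x)\<^sup>2"
      using c(1) by (simp add: power_mult_distrib power2_eq_square[of "A_norm A x"] mult.assoc)
  qed (use c A_norm_nonneg[OF pos] in simp)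
  then show ?thesis
    unfolding A_bounded_def using c by (intro exI[of _ "sqrt c"]) auto
qed

lemma A_bounded_comp:
  assumes "A_bounded A T" "A_bounded A S"
  shows "A_bounded A (T \<circ> S)"
proof -
  obtain c d where c: "c \<ge> 0" "\<And>x. A_norm A (T x) \<le> c * A_norm A x"
    and d: "d \<ge> 0" "\<And>x. A_norm A (S x) \<le> d * A_norm A x"
    using assms unfolding A_bounded_def by blast
  have "A_norm A ((T \<circ> S) x) \<le> (c * d) * A_norm A x" for x
    using order_trans[OF c(2)[of "S x"] mult_left_mono[OF d(2) c(1)]] by (simp add: mult.assoc)
  then show ?thesis
    unfolding A_bounded_def using c d by (intro exI[of _ "c * d"]) auto
qed

lemma A_bounded_add:
  assumes pos: "positive_op A" and "A_bounded A T" "A_bounded A S"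
  shows "A_bounded A (\<lambda>x. T x + S x)"
proof -
  obtain c d where c: "c \<ge> 0" "\<And>x. A_norm A (T x) \<le> c * A_norm A x"
    and d: "d \<ge> 0" "\<And>x. A_norm A (S x) \<le> d * A_norm A x"
    using assms unfolding A_bounded_def by blast
  have "A_norm A (T x + S x) \<le> (c + d) * A_norm A x" for x
    using A_norm_triangle[OF pos, of "T x" "S x"] c(2)[of x] d(2)[of x]
    by (simp add: distrib_right)
  then show ?thesis
    unfolding A_bounded_def using c d by (intro exI[of _ "c + d"]) auto
qed

section \<open>The two suprema\<close>

text \<open>Suprema of real sets are only meaningful when the sets are bounded; boundedness for the seminorm
  guarantees this.\<close>

lemma A_opnorm_bounds:
  assumes T: "A_bounded A T"
  shows "A_opnorm A T \<ge> 0" and "A_norm A x = 1 \<Longrightarrow> A_norm A (T x) \<le> A_opnorm A T"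
proof -
  obtain c where c: "c \<ge> 0" "\<And>x. A_norm A (T x) \<le> c * A_norm A x"
    using T unfolding A_bounded_def by blast
  have "A_norm A (T y) \<le> c" if "A_norm A y = 1" for y
    using c(2)[of y] that by simp
  then have "bdd_above (insert 0 {A_norm A (T x) | x. A_norm A x = 1})"
    using c(1) by (auto intro!: bdd_aboveI[of _ c])
  then show "A_opnorm A T \<ge> 0" "A_norm A x = 1 \<Longrightarrow> A_norm A (T x) \<le> A_opnorm A T"
    unfolding A_opnorm_def by (auto intro!: cSup_upper)
qed

lemma A_opnorm_le:
  assumes "c \<ge> 0" "\<And>x. A_norm A x = 1 \<Longrightarrow> A_norm A (T x) \<le> c"
  shows "A_opnorm A T \<le> c"
  unfolding A_opnorm_def using assms by (intro cSup_least) auto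

lemma A_numrad_bounds:
  assumes "c \<ge> 0" and c: "\<And>x. A_norm A x = 1 \<Longrightarrow> cmod (A_inner A (T x) x) \<le> c"
  shows "0 \<le> A_numrad A T" "A_numrad A T \<le> c"
    and "A_norm A x = 1 \<Longrightarrow> cmod (A_inner A (T x) x) \<le> A_numrad A T"
proof -
  let ?V = "insert 0 {cmod (A_inner A (T x) x) | x. A_norm A x = 1}"
  have "bdd_above ?V"
    using assms by (auto intro!: bdd_aboveI[of _ c])
  then show "0 \<le> A_numrad A T" "A_norm A x = 1 \<Longrightarrow> cmod (A_inner A (T x) x) \<le> A_numrad A T"
    unfolding A_numrad_def by (auto intro!: cSup_upper)
  show "A_numrad A T \<le> c"
    unfolding A_numrad_def using assms by (intro cSup_least) auto
qed

section \<open>The inequality\<close>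

text \<open>Put \<open>p = u v\<close>. Then \<open>(u\<^sup>2 + v\<^sup>2)\<^sup>2 \<le> N + 2 p\<^sup>2\<close>, which settles the case \<open>p \<le> w\<close>. For \<open>p > w\<close> the
  replacement of \<open>p\<close> by \<open>w\<close> under the root costs at most \<open>p - w\<close>: by the inequality of arithmetic and
  geometric means \<open>2 p\<^sup>2 \<le> N\<close>, so
  \<open>q = sqrt (N + 2 w\<^sup>2) \<ge> sqrt (2 p\<^sup>2 + 2 w\<^sup>2) \<ge> p + w\<close>.\<close>

lemma sum_squares_le_sqrt:
  fixes u v w m N :: real
  assumes uv: "0 \<le> u" "0 \<le> v" "u * v \<le> m" and w: "0 \<le> w" "w \<le> m"
    and N: "u ^ 4 + v ^ 4 \<le> N"
  shows "u\<^sup>2 + v\<^sup>2 \<le> sqrt (N + 2 * w\<^sup>2) + (m - w)"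
proof -
  define p where "p = u * v"
  define q where "q = sqrt (N + 2 * w\<^sup>2)"
  have p: "0 \<le> p" "p \<le> m" using uv by (auto simp: p_def)
  have sq: "(u\<^sup>2 + v\<^sup>2)\<^sup>2 \<le> N + 2 * p\<^sup>2"
    using N by (simp add: p_def power2_sum power_mult_distrib flip: power_mult)
  have N2: "2 * p\<^sup>2 \<le> N"
    using sum_squares_bound[of "u\<^sup>2" "v\<^sup>2"] N
    by (simp add: p_def power_mult_distrib flip: power_mult)
  have Nw: "0 \<le> N + 2 * w\<^sup>2"
    using N2 zero_le_power2[of p] zero_le_power2[of w] by linarith
  then have q: "0 \<le> q" "q\<^sup>2 = N + 2 * w\<^sup>2" by (auto simp: q_def)
  show ?thesis
  proof (cases "p \<le> w")
    case True
    then have "p\<^sup>2 \<le> w\<^sup>2" using p by (simp add: power_mono)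
    then have "(u\<^sup>2 + v\<^sup>2)\<^sup>2 \<le> q\<^sup>2"
      using sq q by linarith
    then have "u\<^sup>2 + v\<^sup>2 \<le> q"
      using q(1) by (rule power2_le_imp_le)
    then show ?thesis using w by (simp add: q_def)
  next
    case False
    have "(p + w)\<^sup>2 \<le> q\<^sup>2"
      using N2 sum_squares_bound[of p w] by (simp add: q(2) power2_sum)
    then have "p + w \<le> q"
      using q(1) by (rule power2_le_imp_le)
    \<comment> \<open>The two sides are \<open>2 p\<^sup>2 - 2 w\<^sup>2\<close> and \<open>(q + (p - w))\<^sup>2 - q\<^sup>2\<close>.\<close>
    then have "(p - w) * (2 * (p + w)) \<le> (p - w) * (2 * q + (p - w))"
      using False w by (intro mult_left_mono) auto
    then have "N + 2 * p\<^sup>2 \<le> (q + (p - w))\<^sup>2"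
      using q(2) by (simp add: power2_eq_square algebra_simps)
    then have "(u\<^sup>2 + v\<^sup>2)\<^sup>2 \<le> (q + (p - w))\<^sup>2"
      using sq by linarith
    then have "u\<^sup>2 + v\<^sup>2 \<le> q + (p - w)"
      by (rule power2_le_imp_le) (use q False in simp)
    then show ?thesis using p by (simp add: q_def)
  qed
qed

text \<open>Cauchy-Schwarz for \<open>\<langle>P x, x\<rangle>\<close> with \<open>P = T\<^sup>\<sharp>T\<close>, followed by the symmetry of \<open>P\<close>.\<close>

lemma gram_power4_le:
  assumes pos: "positive_op A" and T: "T \<in> A_adjointable A" and x: "A_norm A x = 1"
  shows "A_norm A (T x) ^ 4 \<le> Re (A_inner A (((A_adj A T \<circ> T) ^^ 2) x) x)"
proof -
  let ?P = "A_adj A T \<circ> T"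
  have "(A_norm A (T x))\<^sup>2 = cmod (A_inner A (?P x) x)"
    by (simp only: A_norm_sq[OF pos] A_inner_gram[OF pos T])
  also have "\<dots> \<le> A_norm A (?P x)"
    using A_cauchy_schwarz[OF pos, of "?P x" x] x by simp
  finally have "((A_norm A (T x))\<^sup>2)\<^sup>2 \<le> (A_norm A (?P x))\<^sup>2"
    by (rule power_mono) simp
  moreover have "complex_of_real ((A_norm A (?P x))\<^sup>2) = A_inner A ((?P ^^ 2) x) x"
    unfolding A_inner_self[OF pos, symmetric]
    by (metis A_inner_gram[OF pos T] comp_apply funpow_0 funpow_Suc_right id_apply numeral_2_eq_2
        funpow.simps)
  then have "(A_norm A (?P x))\<^sup>2 = Re (A_inner A ((?P ^^ 2) x) x)"
    by (metis Re_complex_of_real)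
  ultimately show ?thesis
    by (simp flip: power_mult)
qed

theorem theorem4p3:
  fixes A T S :: "'a::chilbert_space \<Rightarrow> 'a" and \<alpha> :: real
  assumes "(UNIV :: 'a set) \<noteq> {0}"
    and "positive_op A"
    and "T \<in> A_adjointable A"
    and "S \<in> A_adjointable A"
    and "\<alpha> \<in> {0..1}"
  shows "(A_opnorm A (\<lambda>x. T x + S x))\<^sup>2
    \<le> sqrt (A_opnorm A (\<lambda>x. ((A_adj A T \<circ> T) ^^ 2) x + ((A_adj A S \<circ> S) ^^ 2) x)
              + 2 * (A_numrad A (A_adj A S \<circ> T))\<^sup>2)
      + (\<alpha> + 1) * A_opnorm A T * A_opnorm A S
      + (1 - \<alpha>) * A_numrad A (A_adj A S \<circ> T)"
proof -
  note pos = assms(2) and T = assms(3) and S = assms(4)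
  define G where "G = (\<lambda>x. ((A_adj A T \<circ> T) ^^ 2) x + ((A_adj A S \<circ> S) ^^ 2) x)"
  define N where "N = A_opnorm A G"
  define t s w where "t = A_opnorm A T" and "s = A_opnorm A S"
    and "w = A_numrad A (A_adj A S \<circ> T)"
  let ?B = "sqrt (N + 2 * w\<^sup>2) + t * s + w"
  have bT: "A_bounded A T" and bS: "A_bounded A S"
    using A_bounded_adjointable[OF pos] T S by auto
  have bG: "A_bounded A G"
    unfolding G_def numeral_2_eq_2 funpow.simps comp_id
    by (intro A_bounded_add[OF pos] A_bounded_comp A_bounded_gram[OF pos] T S bT bS)
  have N0: "N \<ge> 0" and t0: "t \<ge> 0" and s0: "s \<ge> 0"
    using bG bT bS by (auto simp: N_def t_def s_def intro: A_opnorm_bounds(1))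
  have cross: "A_inner A ((A_adj A S \<circ> T) x) x = A_inner A (T x) (S x)" for x
    using A_inner_A_adj[OF pos S, of x "T x"] A_inner_commute[OF pos] by (metis comp_apply)
  have ts: "A_norm A (T x) * A_norm A (S x) \<le> t * s" if "A_norm A x = 1" for x
    unfolding t_def s_def
    by (intro mult_mono A_opnorm_bounds(2) bT bS that A_opnorm_bounds(1) A_norm_nonneg[OF pos])
  have wb: "cmod (A_inner A ((A_adj A S \<circ> T) x) x) \<le> t * s" if "A_norm A x = 1" for x
    unfolding cross using A_cauchy_schwarz[OF pos] ts[OF that] order_trans by blast
  note w = A_numrad_bounds[of "t * s" A "A_adj A S \<circ> T", OF mult_nonneg_nonneg[OF t0 s0] wb,
      folded w_def]
  have B0: "?B \<ge> 0" using N0 t0 s0 w(1) by simp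
  have pointwise: "(A_norm A (T x + S x))\<^sup>2 \<le> ?B" if x: "A_norm A x = 1" for x
  proof -
    let ?u = "A_norm A (T x)" and ?v = "A_norm A (S x)"
    have "?u ^ 4 + ?v ^ 4 \<le> Re (A_inner A (G x) x)"
      using gram_power4_le[OF pos T x] gram_power4_le[OF pos S x]
      by (simp add: G_def A_inner_add_left[OF pos])
    also have "\<dots> \<le> A_norm A (G x) * A_norm A x"
      using A_cauchy_schwarz[OF pos] complex_Re_le_cmod order_trans by blast
    also have "\<dots> \<le> N"
      using A_opnorm_bounds(2)[OF bG x] x by (simp add: N_def)
    finally have "?u\<^sup>2 + ?v\<^sup>2 \<le> sqrt (N + 2 * w\<^sup>2) + (t * s - w)"
      by (intro sum_squares_le_sqrt A_norm_nonneg[OF pos] ts[OF x] w(1,2))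
    moreover have "Re (A_inner A (T x) (S x)) \<le> w"
      using w(3)[OF _ x] complex_Re_le_cmod[of "A_inner A (T x) (S x)"] unfolding cross by auto
    ultimately show ?thesis
      unfolding A_norm_add_sq[OF pos] by linarith
  qed
  have "A_opnorm A (\<lambda>x. T x + S x) \<le> sqrt ?B"
    using pointwise B0 by (intro A_opnorm_le real_le_rsqrt) auto
  then have "(A_opnorm A (\<lambda>x. T x + S x))\<^sup>2 \<le> (sqrt ?B)\<^sup>2"
    by (intro power_mono A_opnorm_bounds(1) A_bounded_add[OF pos] bT bS)
  also have "\<dots> = ?B" using B0 by simp
  also have "\<dots> \<le> sqrt (N + 2 * w\<^sup>2) + (\<alpha> + 1) * t * s + (1 - \<alpha>) * w"
    using mult_left_mono[OF w(2), of \<alpha>] assms(5) by (simp add: algebra_simps)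
  finally show ?thesis
    unfolding N_def G_def t_def s_def w_def .
qed

end
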